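(* Let $\mathcal{X}\subseteq\mathbb{R}^n$ and let $f:\mathbb{R}^n\to\mathbb{R}$ be a function. Consider the condition $$(E)\qquad \mathcal{X}\ni\mathbf{x}=\sum_{i=1}^k\lambda_i\mathbf{x}_i,\ \ \boldsymbol{\lambda}\in\Delta_k,\ \ \mathbf{x}_i\in\mathcal{X}\ (i=1,\dots,k)\ \Longrightarrow\ f(\mathbf{x})\ge\sum_{i=1}^k\lambda_i f(\mathbf{x}_i)$$ (required for all positive integers $k$ and all such $\mathbf{x},\boldsymbol{\lambda},\mathbf{x}_i$). Then (E) is necessary for the existence of a concave tent of $f$ over $\mathcal{X}$. If $\mathcal{X}$ is compact and $f$ is continuous over $\mathcal{X}$, then (E) is also sufficient for the existence of a concave tent of $f$ over $\mathcal{X}$.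
   Context: $\Delta_k=\{\boldsymbol{\lambda}\in\mathbb{R}^k:\lambda_i\ge 0,\ \sum_i\lambda_i=1\}$. Given $\mathcal{X}\subseteq\mathbb{R}^n$ and $f:\mathbb{R}^n\to\mathbb{R}$, a concave tent of $f$ over $\mathcal{X}$ is a function $g:\mathbb{R}^n\to\mathbb{R}\cup\{\pm\infty\}$ such that (i) $g$ is concave over $\operatorname{conv}(\mathcal{X})$ (for extended-valued $g$: the set $\{(\mathbf{x},t):\mathbf{x}\in\operatorname{conv}(\mathcal{X}),\ t\in\mathbb{R},\ t\le g(\mathbf{x})\}$ is convex), and (ii) $g(\mathbf{x})=f(\mathbf{x})$ for all $\mathbf{x}\in\mathcal{X}$. *)

theory Defs
  imports "HOL-Analysis.Analysis"
begin

(* Vectors of R^k are functions on nat of which only the values at 1,...,k matter. *)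
definition std_simplex :: "nat \<Rightarrow> (nat \<Rightarrow> real) set" where
  "std_simplex k = {l. (\<forall>i\<in>{1..k}. 0 \<le> l i) \<and> (\<Sum>i=1..k. l i) = 1}"

(* The library's concave_on covers real-valued functions only. Here t ranges over the finite
   reals, so g may take both infinite values without an expression like \<infinity> - \<infinity> arising. *)
definition ereal_concave_on :: "'a::real_vector set \<Rightarrow> ('a \<Rightarrow> ereal) \<Rightarrow> bool" where
  "ereal_concave_on S g \<longleftrightarrow> convex {(x, t::real). x \<in> S \<and> ereal t \<le> g x}"

definition concave_tent ::
    "(real ^ 'n) set \<Rightarrow> (real ^ 'n \<Rightarrow> real) \<Rightarrow> (real ^ 'n \<Rightarrow> ereal) \<Rightarrow> bool" where
  "concave_tent X f g \<longleftrightarrow>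
     ereal_concave_on (convex hull X) g \<and> (\<forall>x\<in>X. g x = ereal (f x))"

definition tent_condition :: "(real ^ 'n) set \<Rightarrow> (real ^ 'n \<Rightarrow> real) \<Rightarrow> bool" where
  "tent_condition X f \<longleftrightarrow>
     (\<forall>k::nat. \<forall>x. \<forall>l\<in>std_simplex k. \<forall>xs :: nat \<Rightarrow> real ^ 'n.
        k \<ge> 1 \<longrightarrow> x \<in> X \<longrightarrow> (\<forall>i\<in>{1..k}. xs i \<in> X) \<longrightarrow> x = (\<Sum>i=1..k. l i *\<^sub>R xs i) \<longrightarrow>
        f x \<ge> (\<Sum>i=1..k. l i * f (xs i)))"

end

theory Submission
  imports Defs
begin

text \<open>
  Both directions compare the graph \<open>G\<close> of \<open>f\<close> over \<open>X\<close> with hypographs. The hypograph of a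
  concave tent is a convex set containing \<open>G\<close>, hence containing every convex combination of
  points of \<open>G\<close>; where such a combination lies over a point of \<open>X\<close>, its height is at most the
  value of the tent, which is \<open>f\<close> there. This is the tent condition.

  Conversely, the tent condition says that no point of the convex hull of \<open>G\<close> lying over \<open>X\<close>
  rises above \<open>G\<close> (lemma \<open>tent_condition_hull_graph_le\<close>). The upper envelope of that hull, the
  function that sends a point to the supremum of the heights of the hull above it, therefore
  agrees with \<open>f\<close> on \<open>X\<close>. It is concave because it is the upper envelope of a convex set (lemma
  \<open>ereal_concave_on_upper_envelope\<close>).
\<close>

text \<open>
  Over a point outside the projection of \<open>K\<close> the supremum is empty, so the value there is
  \<open>-\<infinity>\<close>; it is \<open>\<infinity>\<close> where the heights of \<open>K\<close> are unbounded above.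
\<close>

definition upper_envelope :: "('a \<times> real) set \<Rightarrow> 'a \<Rightarrow> ereal" where
  "upper_envelope K x = (SUP t\<in>{t. (x, t) \<in> K}. ereal t)"

lemma upper_envelope_upper: "(x, t) \<in> K \<Longrightarrow> ereal t \<le> upper_envelope K x"
  unfolding upper_envelope_def by (rule SUP_upper) simp

text \<open>
  Two points below the envelope need not lie below points of \<open>K\<close>, but they do after being lowered
  by any \<open>e > 0\<close>; so the combination of the two, lowered by \<open>e\<close>, lies below the envelope, and
  then \<open>e\<close> tends to zero.
\<close>

lemma ereal_concave_on_upper_envelope:
  fixes S :: "'a::real_vector set"
  assumes S: "convex S" and K: "convex K"
  shows "ereal_concave_on S (upper_envelope K)"
proof -
  have near: "\<exists>s. (x, s) \<in> K \<and> t - e < s"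
    if "ereal t \<le> upper_envelope K x" "0 < e" for x t e
  proof -
    have "ereal (t - e) < upper_envelope K x"
      using that by (auto intro!: less_le_trans[OF _ that(1)])
    then show ?thesis
      unfolding upper_envelope_def less_SUP_iff by auto
  qed
  have "ereal (u * t + v * s) \<le> upper_envelope K (u *\<^sub>R x + v *\<^sub>R y)"
    if x: "ereal t \<le> upper_envelope K x" and y: "ereal s \<le> upper_envelope K y"
      and uv: "0 \<le> u" "0 \<le> v" "u + v = 1" for x y t s u v
  proof (rule ereal_le_epsilon2)
    fix e :: real
    assume e: "0 < e"
    obtain t' where t': "(x, t') \<in> K" "t - e < t'"
      using near[OF x e] by blast
    obtain s' where s': "(y, s') \<in> K" "s - e < s'"
      using near[OF y e] by blast
    have "(u *\<^sub>R x + v *\<^sub>R y, u * t' + v * s') \<in> K"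
      using convexD[OF K t'(1) s'(1) uv] by simp
    then have K': "ereal (u * t' + v * s') \<le> upper_envelope K (u *\<^sub>R x + v *\<^sub>R y)"
      by (rule upper_envelope_upper)
    have "u * (t - e) + v * (s - e) \<le> u * t' + v * s'"
      using t'(2) s'(2) uv by (intro add_mono mult_left_mono) auto
    moreover have "u * (t - e) + v * (s - e) = u * t + v * s - (u + v) * e"
      by (simp add: algebra_simps)
    ultimately have "u * t + v * s \<le> u * t' + v * s' + e"
      using uv(3) by simp
    then have "ereal (u * t + v * s) \<le> ereal (u * t' + v * s') + ereal e"
      by simp
    also have "\<dots> \<le> upper_envelope K (u *\<^sub>R x + v *\<^sub>R y) + ereal e"
      using K' by (rule add_right_mono)
    finally show "ereal (u * t + v * s) \<le> upper_envelope K (u *\<^sub>R x + v *\<^sub>R y) + ereal e" .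
  qed
  then show ?thesis
    unfolding ereal_concave_on_def by (intro convexI) (auto intro: convexD[OF S])
qed

lemma concave_tent_imp_tent_condition:
  fixes X :: "(real ^ 'n) set"
  assumes "concave_tent X f g"
  shows "tent_condition X f"
  unfolding tent_condition_def
proof (intro allI ballI impI)
  fix k x l and xs :: "nat \<Rightarrow> real ^ 'n"
  assume l: "l \<in> std_simplex k" and x: "x \<in> X" and xs: "\<forall>i\<in>{1..k}. xs i \<in> X"
    and x_eq: "x = (\<Sum>i=1..k. l i *\<^sub>R xs i)"
  define H where "H = {(y, t::real). y \<in> convex hull X \<and> ereal t \<le> g y}"
  have "convex H" and g: "\<And>y. y \<in> X \<Longrightarrow> g y = ereal (f y)"
    using assms unfolding concave_tent_def ereal_concave_on_def H_def by auto
  then have "(\<Sum>i=1..k. l i *\<^sub>R (xs i, f (xs i))) \<in> H"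
    using l xs by (intro convex_sum) (simp_all add: std_simplex_def H_def hull_inc)
  moreover have "(\<Sum>i=1..k. l i *\<^sub>R (xs i, f (xs i))) = (x, \<Sum>i=1..k. l i * f (xs i))"
    by (simp add: prod_eq_iff fst_sum snd_sum x_eq)
  ultimately show "(\<Sum>i=1..k. l i * f (xs i)) \<le> f x"
    using g[OF x] by (simp add: H_def)
qed

text \<open>
  A point of the hull is a convex combination of points \<open>(y, f y)\<close>. Its first component is the
  combination of the \<open>y\<close> that the tent condition is applied to, and its second component \<open>t\<close> is
  the sum that the condition bounds.
\<close>

lemma tent_condition_hull_graph_le:
  assumes E: "tent_condition X f" and x: "x \<in> X"
    and hull: "(x, t) \<in> convex hull ((\<lambda>y. (y, f y)) ` X)"
  shows "t \<le> f x"
proof -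
  obtain k u p where p: "\<forall>i\<in>{1::nat..k}. 0 \<le> u i \<and> p i \<in> (\<lambda>y. (y, f y)) ` X"
    and u: "sum u {1..k} = 1" and sum: "(\<Sum>i=1..k. u i *\<^sub>R p i) = (x, t)"
    using hull unfolding convex_hull_indexed by blast
  have "k \<ge> 1"
    using u by (cases k) auto
  moreover have "u \<in> std_simplex k"
    using p u by (simp add: std_simplex_def)
  moreover have "\<forall>i\<in>{1..k}. fst (p i) \<in> X"
    using p by fastforce
  moreover have "x = (\<Sum>i=1..k. u i *\<^sub>R fst (p i))"
    using arg_cong[OF sum, of fst] by (simp add: fst_sum)
  ultimately have "(\<Sum>i=1..k. u i * f (fst (p i))) \<le> f x"
    using E[unfolded tent_condition_def, rule_format, of u k x "\<lambda>i. fst (p i)"] x by blast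
  moreover have "(\<Sum>i=1..k. u i * f (fst (p i))) = (\<Sum>i=1..k. u i * snd (p i))"
    using p by (intro sum.cong) fastforce+
  moreover have "\<dots> = t"
    using arg_cong[OF sum, of snd] by (simp add: snd_sum)
  ultimately show ?thesis
    by simp
qed

lemma tent_condition_imp_concave_tent:
  assumes E: "tent_condition X f"
  shows "concave_tent X f (upper_envelope (convex hull ((\<lambda>x. (x, f x)) ` X)))"
    (is "concave_tent X f (upper_envelope ?K)")
proof -
  have "upper_envelope ?K x = ereal (f x)" if x: "x \<in> X" for x
  proof (rule antisym)
    show "upper_envelope ?K x \<le> ereal (f x)"
      unfolding upper_envelope_def
      using tent_condition_hull_graph_le[OF E x] by (intro SUP_least) simp
    show "ereal (f x) \<le> upper_envelope ?K x"
      using x by (intro upper_envelope_upper hull_inc) auto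
  qed
  then show ?thesis
    unfolding concave_tent_def
    by (simp add: ereal_concave_on_upper_envelope)
qed

theorem proposition2:
  fixes X :: "(real ^ 'n) set" and f :: "real ^ 'n \<Rightarrow> real"
  shows "((\<exists>g. concave_tent X f g) \<longrightarrow> tent_condition X f) \<and>
         (compact X \<and> continuous_on X f \<longrightarrow> tent_condition X f \<longrightarrow> (\<exists>g. concave_tent X f g))"
  using concave_tent_imp_tent_condition tent_condition_imp_concave_tent by blast

end
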